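(* Let $N\ge1$ be an integer, let $\boldsymbol u=\boldsymbol u(\xi)$ be a solution of the Navier-Stokes system with forcing $\mathbf f(\xi,\cdot)$, let $\boldsymbol u^N=\mathcal P^N\boldsymbol u$ be its orthogonal projection and $\boldsymbol u^{(N)}$ its discrete projection (pseudo-spectral approximation) based on Gauss quadrature. Define $$\delta_N=\sup_{\xi}|\boldsymbol u(\xi)-\boldsymbol u^N(\xi)|_{1,2}.$$ Then $$\mathbb E|\boldsymbol u-\boldsymbol u^{(N)}|_{1,2}^2\le\mathbb E|\boldsymbol u-\boldsymbol u^N|_{1,2}^2+N\,(\delta_N)^2.$$
   Context: $G\subset\mathbb R^2$ is a bounded domain with locally Lipschitz boundary; $\nu>0$ is a constant. For a vector field $\mathbf g=(g^1,g^2)$ on $G$, $|\mathbf g|_{1,2}^2=\sum_{i,j=1}^2\int_G|\partial g^i/\partial x_j|^2dx$. $\mathcal D(G)$ is the set of divergence-free vector fields with components in $C_0^\infty(G)$; $\widehat{\mathbf H}^{1,2}_0(G)$ is the completion of $\mathcal D(G)$ in $|\cdot|_{1,2}$; $\mathbf H^{-1,2}_0(G)$ is the dual of the space $\mathbf H^{1,2}_0(G)$ (completion of $C_0^\infty(G)^2$ in $|\cdot|_{1,2}$), with dual norm $|\cdot|_{-1,2}$ and duality $\langle\cdot,\cdot\rangle_1$. $\xi$ is a random variable on a probability space $(\Omega,\mathcal F,\mathbb P)$ whose moment generating function $\lambda\mapsto\mathbb Ee^{\lambda\xi}$ is finite in a neighborhood of $0$. $\{P_n,\ n\ge0\}$ are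 orthogonal polynomials ($\deg P_n=n$) for the distribution of $\xi$; $\mathfrak P_n=P_n(\xi)$ and $c(n)=\mathbb E\mathfrak P_n^2>0$; then $\{\mathfrak P_n\}$ is an orthogonal basis of $L_2(\Omega,\mathcal F_\xi,\mathbb P)$, where $\mathcal F_\xi$ is the completed sigma-algebra generated by $\xi$. Let $I$ be the smallest closed interval containing the support of the distribution of $\xi$; "values of $\xi$" means points of $I$, and $\sup_\xi$ is the supremum over $\xi\in I$. The forcing is $\boldsymbol f(x)=\mathbf f(\xi,x)$ with non-random $\mathbf f$, and $\boldsymbol f\in L^2(\Omega;\mathbf H^{-1,2}_0(G))$. For every value $\xi\in I$, $\boldsymbol u(\xi)\in\widehat{\mathbf H}^{1,2}_0(G)$ solves the steady Navier-Stokes system with forcing $\mathbf f(\xi,\cdot)$: for all $\boldsymbol\varphi\in\mathcal D(G)$, $$\nu\sum_{i,j}\int_G\frac{\partial u^i}{\partial x_j}\frac{\partial\varphi^i}{\partial x_j}dx+\int_G\sum_{i,j}u^j\frac{\partial u^i}{\partial x_j}\varphi^i\,dx=-\langle\mathbf f(\xi,\cdot),\boldsymbol\varphi\rangle_1,$$ and $\boldsymbol u(\xi)$, as a random element, belongs to $L^2(\Omega;\widehat{\mathbf H}^{1,2}_0(G))$. Orthogonal projection: $\boldsymbol u^N(\xi)=\sum_{k=0}^N\mathbf u_k\frac{P_k(\xi)}{c(k)}$, $\mathbf u_k=\mathbb E(\boldsymbol u\,\mathfrak P_k)$; it is regarded as a polynomial function of $\xi\in I$. Discrete projection: let $\xi_{j,N}$,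 $j=1,\dots,N+1$, be the roots of $P_{N+1}$ and $w_{j,N}>0$ the corresponding Gauss quadrature weights, so that $\mathbb Eh(\xi)=\sum_{j=1}^{N+1}w_{j,N}h(\xi_{j,N})$ for all polynomials $h$ of degree at most $2N+1$. Then $\boldsymbol u^{(N)}(\xi)=\sum_{k=0}^N\mathbf u_k^{(N)}\frac{P_k(\xi)}{c(k)}$ with $\mathbf u_k^{(N)}=\sum_{j=1}^{N+1}w_{j,N}\boldsymbol u(\xi_{j,N})P_k(\xi_{j,N})$. *)

theory Defs
  imports "HOL-Probability.Probability" "HOL-Computational_Algebra.Polynomial"
begin

section \<open>Test functions and domains in the plane\<close>

type_synonym plane = "real ^ 2"
type_synonym vfield = "plane \<Rightarrow> plane"

definition partial :: "2 \<Rightarrow> (plane \<Rightarrow> real) \<Rightarrow> plane \<Rightarrow> real" where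
  "partial j f x = frechet_derivative f (at x) (axis j 1)"

primrec Ck :: "nat \<Rightarrow> (plane \<Rightarrow> real) \<Rightarrow> bool" where
  "Ck 0 f \<longleftrightarrow> continuous_on UNIV f"
| "Ck (Suc k) f \<longleftrightarrow> (\<forall>x. f differentiable (at x)) \<and> (\<forall>j. Ck k (partial j f))"

text \<open>Elements of the spaces of test functions are functions on the whole plane whose (compact)
  support lies in \<open>G\<close>, i.e. they are extended by zero outside \<open>G\<close>.\<close>

definition test_functions :: "plane set \<Rightarrow> (plane \<Rightarrow> real) set" where
  "test_functions G =
     {\<phi>. (\<forall>k. Ck k \<phi>) \<and> compact (closure {x. \<phi> x \<noteq> 0}) \<and> closure {x. \<phi> x \<noteq> 0} \<subseteq> G}"

definition test_fields :: "plane set \<Rightarrow> vfield set" where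
  "test_fields G = {\<phi>. \<forall>i. (\<lambda>x. \<phi> x $ i) \<in> test_functions G}"

definition divfree_test_fields :: "plane set \<Rightarrow> vfield set" where
  "divfree_test_fields G =
     {\<phi> \<in> test_fields G. \<forall>x\<in>G. (\<Sum>i\<in>UNIV. partial i (\<lambda>y. \<phi> y $ i) x) = 0}"

definition norm12 :: "plane set \<Rightarrow> vfield \<Rightarrow> real" where
  "norm12 G g =
     sqrt (\<Sum>i\<in>UNIV. \<Sum>j\<in>UNIV. LINT x:G|lborel. (partial j (\<lambda>y. g y $ i) x)\<^sup>2)"

text \<open>Near each boundary point \<open>x\<close>, in Cartesian coordinates obtained by a translation and an
  orthogonal map \<open>T\<close>, the set \<open>G\<close> is the region above the graph of a Lipschitz function.\<close>

definition locally_Lipschitz_boundary :: "plane set \<Rightarrow> bool" where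
  "locally_Lipschitz_boundary G \<longleftrightarrow>
     (\<forall>x\<in>frontier G. \<exists>\<epsilon>>0. \<exists>T :: plane \<Rightarrow> plane. \<exists>\<psi> :: real \<Rightarrow> real. \<exists>L.
        orthogonal_transformation T \<and> L-lipschitz_on UNIV \<psi> \<and>
        (\<forall>y\<in>ball x \<epsilon>. y \<in> G \<longleftrightarrow> T (y - x) $ 2 > \<psi> (T (y - x) $ 1)))"

definition Lipschitz_domain :: "plane set \<Rightarrow> bool" where
  "Lipschitz_domain G \<longleftrightarrow>
     open G \<and> connected G \<and> G \<noteq> {} \<and> bounded G \<and> locally_Lipschitz_boundary G"


section \<open>Completions in the norm \<open>norm12\<close>\<close>

text \<open>The completion of a space \<open>V\<close> of fields in the norm \<open>norm12 G\<close>: a Hilbert space \<open>'h\<close>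
  together with a linear isometry \<open>\<iota>\<close> of \<open>V\<close> onto a dense subspace of \<open>'h\<close>.  This determines
  \<open>'h\<close> and \<open>\<iota>\<close> up to a unique isometric isomorphism, and the norm of \<open>'h\<close> is the extension of
  \<open>norm12 G\<close> to the completion.  The spaces of test fields are separable in this norm, so a
  completion is always second countable; where the class \<open>second_countable_topology\<close> appears
  below, it only gives access to the Bochner integral.\<close>

definition completion12 ::
    "plane set \<Rightarrow> vfield set \<Rightarrow> (vfield \<Rightarrow> 'h::{real_inner, banach}) \<Rightarrow> bool" where
  "completion12 G V \<iota> \<longleftrightarrow>
     (\<forall>\<phi>\<in>V. \<forall>\<psi>\<in>V. \<forall>a b. \<iota> (\<lambda>x. a *\<^sub>R \<phi> x + b *\<^sub>R \<psi> x) = a *\<^sub>R \<iota> \<phi> + b *\<^sub>R \<iota> \<psi>) \<and>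
     (\<forall>\<phi>\<in>V. norm (\<iota> \<phi>) = norm12 G \<phi>) \<and>
     closure (\<iota> ` V) = UNIV"

text \<open>The vector field \<open>v\<close> on \<open>G\<close> represented by an element \<open>U\<close> of the completion.  By the
  Poincare inequality on the bounded set \<open>G\<close>, every sequence in \<open>V\<close> converging to \<open>U\<close> in the
  completion converges in \<open>L\<^sup>2(G)\<close>; so \<open>v\<close> exists and is unique up to null sets.\<close>

definition represents ::
    "plane set \<Rightarrow> vfield set \<Rightarrow> (vfield \<Rightarrow> 'h::{real_inner, banach}) \<Rightarrow>
     'h \<Rightarrow> vfield \<Rightarrow> bool" where
  "represents G V \<iota> U v \<longleftrightarrow>
     set_borel_measurable lborel G v \<and>
     (\<exists>\<phi>. (\<forall>n::nat. \<phi> n \<in> V) \<and> (\<lambda>n. \<iota> (\<phi> n)) \<longlonglongrightarrow> U \<and>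
        (\<lambda>n. \<integral>\<^sup>+ x\<in>G. ennreal ((norm (\<phi> n x - v x))\<^sup>2) \<partial>lborel) \<longlonglongrightarrow> 0)"

definition has_weak_partial ::
    "plane set \<Rightarrow> 2 \<Rightarrow> (plane \<Rightarrow> real) \<Rightarrow> (plane \<Rightarrow> real) \<Rightarrow> bool" where
  "has_weak_partial G j f g \<longleftrightarrow>
     (\<forall>K. compact K \<and> K \<subseteq> G \<longrightarrow> set_integrable lborel K f \<and> set_integrable lborel K g) \<and>
     (\<forall>\<phi>\<in>test_functions G.
        (LINT x:G|lborel. g x * \<phi> x) = - (LINT x:G|lborel. f x * partial j \<phi> x))"


section \<open>The steady Navier-Stokes system\<close>

text \<open>\<open>\<iota>\<close> realizes the completion of the divergence-free test fields and \<open>\<kappa>\<close> that of all test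
  fields; the forcing \<open>F\<close> is an element of the dual of the latter.  The matrix field \<open>Dv\<close> is the
  weak gradient of the field \<open>v\<close> represented by \<open>U\<close>: \<open>Dv x $ i $ j\<close> is the derivative of the
  \<open>i\<close>-th component in direction \<open>j\<close>.  Both \<open>v\<close> and \<open>Dv\<close> are unique up to null sets.\<close>

definition steady_NS_solution ::
    "real \<Rightarrow> plane set \<Rightarrow> (vfield \<Rightarrow> 'h::{real_inner, banach}) \<Rightarrow>
     (vfield \<Rightarrow> 'w::{real_inner, banach}) \<Rightarrow> ('w \<Rightarrow>\<^sub>L real) \<Rightarrow> 'h \<Rightarrow> bool" where
  "steady_NS_solution \<nu> G \<iota> \<kappa> F U \<longleftrightarrow>
     (\<exists>v. \<exists>Dv :: plane \<Rightarrow> real ^ 2 ^ 2.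
        represents G (divfree_test_fields G) \<iota> U v \<and>
        (\<forall>i j. has_weak_partial G j (\<lambda>x. v x $ i) (\<lambda>x. Dv x $ i $ j)) \<and>
        (\<forall>\<phi>\<in>divfree_test_fields G.
           \<nu> * (\<Sum>i\<in>UNIV. \<Sum>j\<in>UNIV.
                  LINT x:G|lborel. Dv x $ i $ j * partial j (\<lambda>y. \<phi> y $ i) x)
           + (LINT x:G|lborel. \<Sum>i\<in>UNIV. \<Sum>j\<in>UNIV. v x $ j * Dv x $ i $ j * \<phi> x $ i)
           = - blinfun_apply F (\<kappa> \<phi>)))"


section \<open>Polynomial chaos projections\<close>

definition distr_support :: "'a measure \<Rightarrow> ('a \<Rightarrow> real) \<Rightarrow> real set" where
  "distr_support M \<xi> = {x. \<forall>\<epsilon>>0. measure (distr M borel \<xi>) (ball x \<epsilon>) > 0}"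

definition value_interval :: "'a measure \<Rightarrow> ('a \<Rightarrow> real) \<Rightarrow> real set" where
  "value_interval M \<xi> = \<Inter> {J. closed J \<and> is_interval J \<and> distr_support M \<xi> \<subseteq> J}"

definition finite_mgf_near_0 :: "'a measure \<Rightarrow> ('a \<Rightarrow> real) \<Rightarrow> bool" where
  "finite_mgf_near_0 M \<xi> \<longleftrightarrow>
     (\<exists>\<epsilon>>0. \<forall>s::real. \<bar>s\<bar> < \<epsilon> \<longrightarrow> integrable M (\<lambda>\<omega>. exp (s * \<xi> \<omega>)))"

definition sq_norm :: "'a measure \<Rightarrow> ('a \<Rightarrow> real) \<Rightarrow> (nat \<Rightarrow> real poly) \<Rightarrow> nat \<Rightarrow> real" where
  "sq_norm M \<xi> P n = (\<integral>\<omega>. (poly (P n) (\<xi> \<omega>))\<^sup>2 \<partial>M)"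

definition orthogonal_polynomials ::
    "'a measure \<Rightarrow> ('a \<Rightarrow> real) \<Rightarrow> (nat \<Rightarrow> real poly) \<Rightarrow> bool" where
  "orthogonal_polynomials M \<xi> P \<longleftrightarrow>
     (\<forall>n. degree (P n) = n) \<and>
     (\<forall>m n. m \<noteq> n \<longrightarrow> (\<integral>\<omega>. poly (P m) (\<xi> \<omega>) * poly (P n) (\<xi> \<omega>) \<partial>M) = 0) \<and>
     (\<forall>n. sq_norm M \<xi> P n > 0)"

definition chaos_coeff ::
    "'a measure \<Rightarrow> ('a \<Rightarrow> real) \<Rightarrow> (nat \<Rightarrow> real poly) \<Rightarrow>
     (real \<Rightarrow> 'h::{real_inner, banach, second_countable_topology}) \<Rightarrow> nat \<Rightarrow> 'h" where
  "chaos_coeff M \<xi> P u k = (\<integral>\<omega>. poly (P k) (\<xi> \<omega>) *\<^sub>R u (\<xi> \<omega>) \<partial>M)"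

definition orth_projection ::
    "'a measure \<Rightarrow> ('a \<Rightarrow> real) \<Rightarrow> (nat \<Rightarrow> real poly) \<Rightarrow>
     (real \<Rightarrow> 'h::{real_inner, banach, second_countable_topology}) \<Rightarrow>
     nat \<Rightarrow> real \<Rightarrow> 'h" where
  "orth_projection M \<xi> P u N t =
     (\<Sum>k=0..N. (poly (P k) t / sq_norm M \<xi> P k) *\<^sub>R chaos_coeff M \<xi> P u k)"

text \<open>\<open>z 1, \<dots>, z (N + 1)\<close> are the roots of \<open>P (N + 1)\<close>, each listed once, and \<open>w j\<close> is the
  weight belonging to \<open>z j\<close>.\<close>

definition Gauss_quadrature ::
    "'a measure \<Rightarrow> ('a \<Rightarrow> real) \<Rightarrow> (nat \<Rightarrow> real poly) \<Rightarrow> nat \<Rightarrow>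
     (nat \<Rightarrow> real) \<Rightarrow> (nat \<Rightarrow> real) \<Rightarrow> bool" where
  "Gauss_quadrature M \<xi> P N z w \<longleftrightarrow>
     bij_betw z {1..N + 1} {t. poly (P (N + 1)) t = 0} \<and>
     (\<forall>j\<in>{1..N + 1}. w j > 0) \<and>
     (\<forall>h :: real poly. degree h \<le> 2 * N + 1 \<longrightarrow>
        (\<integral>\<omega>. poly h (\<xi> \<omega>) \<partial>M) = (\<Sum>j=1..N + 1. w j * poly h (z j)))"

definition discrete_coeff ::
    "(nat \<Rightarrow> real poly) \<Rightarrow> nat \<Rightarrow> (nat \<Rightarrow> real) \<Rightarrow> (nat \<Rightarrow> real) \<Rightarrow>
     (real \<Rightarrow> 'h::real_normed_vector) \<Rightarrow> nat \<Rightarrow> 'h" where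
  "discrete_coeff P N z w u k = (\<Sum>j=1..N + 1. (w j * poly (P k) (z j)) *\<^sub>R u (z j))"

definition discrete_projection ::
    "'a measure \<Rightarrow> ('a \<Rightarrow> real) \<Rightarrow> (nat \<Rightarrow> real poly) \<Rightarrow>
     (nat \<Rightarrow> real) \<Rightarrow> (nat \<Rightarrow> real) \<Rightarrow> (real \<Rightarrow> 'h::real_normed_vector) \<Rightarrow>
     nat \<Rightarrow> real \<Rightarrow> 'h" where
  "discrete_projection M \<xi> P z w u N t =
     (\<Sum>k=0..N. (poly (P k) t / sq_norm M \<xi> P k) *\<^sub>R discrete_coeff P N z w u k)"

text \<open>The supremum may be infinite, hence its type.\<close>

definition sup_error ::
    "'a measure \<Rightarrow> ('a \<Rightarrow> real) \<Rightarrow> (nat \<Rightarrow> real poly) \<Rightarrow>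
     (real \<Rightarrow> 'h::{real_inner, banach, second_countable_topology}) \<Rightarrow>
     nat \<Rightarrow> ennreal" where
  "sup_error M \<xi> P u N =
     (SUP t\<in>value_interval M \<xi>. ennreal (norm (u t - orth_projection M \<xi> P u N t)))"

text \<open>Square-integrable random elements.  The spaces in question are separable, so
  Borel measurability coincides with strong measurability.\<close>

definition L2_random_element :: "'a measure \<Rightarrow> ('a \<Rightarrow> 'b::real_normed_vector) \<Rightarrow> bool" where
  "L2_random_element M X \<longleftrightarrow>
     X \<in> borel_measurable M \<and> integrable M (\<lambda>\<omega>. (norm (X \<omega>))\<^sup>2)"

end

theory Submission
  imports Defs
begin

text \<open>The error \<open>e = u - u\<^sup>N\<close> is orthogonal to all polynomials of degree at most \<open>N\<close>, and
  \<open>u\<^sup>(\<^sup>N\<^sup>) - u\<^sup>N = (\<Sum>k\<le>N. (P k / c k) d\<^sub>k)\<close> with \<open>d\<^sub>k = (\<Sum>j. w\<^sub>j P k (z\<^sub>j) e(z\<^sub>j))\<close>, because the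
  quadrature is exact on products of polynomials of degree at most \<open>N\<close>.  By Pythagoras
  \<open>E |u - u\<^sup>(\<^sup>N\<^sup>)|\<^sup>2 = E |e|\<^sup>2 + (\<Sum>k. |d\<^sub>k|\<^sup>2 / c k)\<close>, and Bessel's inequality for the discrete inner
  product bounds the last sum by \<open>(\<Sum>j. w\<^sub>j |e(z\<^sub>j)|\<^sup>2)\<close>.  This is at most the square of the
  supremum, as the weights add up to \<open>1\<close> and the nodes lie in the interval of values of \<open>\<xi>\<close>.\<close>

section \<open>Bessel's inequality in inner product spaces\<close>

lemma norm_diff_sum_squared:
  fixes v :: "'h::real_inner" and d :: "nat \<Rightarrow> 'h"
  shows "(norm (v - (\<Sum>k=0..N. a k *\<^sub>R d k)))\<^sup>2 =
    (norm v)\<^sup>2 - 2 * (\<Sum>k=0..N. a k * (v \<bullet> d k))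
      + (\<Sum>k=0..N. \<Sum>l=0..N. a k * a l * (d k \<bullet> d l))"
proof -
  let ?S = "\<Sum>k=0..N. a k *\<^sub>R d k"
  have "(norm (v - ?S))\<^sup>2 = v \<bullet> v - 2 * (v \<bullet> ?S) + ?S \<bullet> ?S"
    unfolding power2_norm_eq_inner by (simp add: inner_diff_left inner_diff_right inner_commute)
  moreover have "v \<bullet> ?S = (\<Sum>k=0..N. a k * (v \<bullet> d k))"
    by (simp add: inner_sum_right)
  moreover have "?S \<bullet> ?S = (\<Sum>k=0..N. \<Sum>l=0..N. a k * a l * (d k \<bullet> d l))"
    by (simp add: inner_sum_right inner_sum_left sum_distrib_left mult_ac inner_commute)
  ultimately show ?thesis by (simp add: power2_norm_eq_inner)
qed

lemma sum_diagonal: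
  fixes g :: "nat \<Rightarrow> nat \<Rightarrow> real"
  assumes "\<And>k l. k \<le> N \<Longrightarrow> l \<le> N \<Longrightarrow> k \<noteq> l \<Longrightarrow> g k l = 0"
  shows "(\<Sum>k=0..N. \<Sum>l=0..N. g k l) = (\<Sum>k=0..N. g k k)"
proof (rule sum.cong[OF refl])
  fix k assume "k \<in> {0..N}"
  then have "(\<Sum>l=0..N. g k l) = (\<Sum>l=0..N. if l = k then g k k else 0)"
    using assms by (intro sum.cong) auto
  then show "(\<Sum>l=0..N. g k l) = g k k" using \<open>k \<in> {0..N}\<close> by simp
qed

text \<open>The weights are nonnegative, so the weighted sum of the squared norms of the residuals
  \<open>v j - (\<Sum>k. (p k j / c k) *\<^sub>R d k)\<close> is nonnegative, where
  \<open>d k\<close> are the coefficients on the left. By orthogonality it equals the right side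
  minus the left.\<close>

lemma weighted_Bessel_inequality:
  fixes v :: "'i \<Rightarrow> 'h::real_inner" and p :: "nat \<Rightarrow> 'i \<Rightarrow> real"
  assumes w: "\<And>j. j \<in> J \<Longrightarrow> w j \<ge> 0"
    and orth: "\<And>k l. k \<le> N \<Longrightarrow> l \<le> N \<Longrightarrow>
      (\<Sum>j\<in>J. w j * (p k j * p l j)) = (if k = l then c k else 0)"
    and c: "\<And>k. k \<le> N \<Longrightarrow> c k > 0"
  shows "(\<Sum>k=0..N. (norm (\<Sum>j\<in>J. (w j * p k j) *\<^sub>R v j))\<^sup>2 / c k) \<le> (\<Sum>j\<in>J. w j * (norm (v j))\<^sup>2)"
proof -
  define d where "d k = (\<Sum>j\<in>J. (w j * p k j) *\<^sub>R v j)" for k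
  have "0 \<le> (\<Sum>j\<in>J. w j * (norm (v j - (\<Sum>k=0..N. (p k j / c k) *\<^sub>R d k)))\<^sup>2)"
    using w by (intro sum_nonneg) simp
  also have "\<dots> = (\<Sum>j\<in>J. w j * (norm (v j))\<^sup>2)
      - 2 * (\<Sum>j\<in>J. \<Sum>k=0..N. w j * (p k j / c k * (v j \<bullet> d k)))
      + (\<Sum>j\<in>J. \<Sum>k=0..N. \<Sum>l=0..N. w j * (p k j / c k * (p l j / c l) * (d k \<bullet> d l)))"
    unfolding norm_diff_sum_squared
    by (simp only: distrib_left right_diff_distrib sum.distrib sum_subtractf
        sum_distrib_left mult.left_commute[of _ 2])
  \<comment> \<open>After interchanging the sums, the sum over \<open>j\<close> reassembles
    \<open>d k\<close> itself.\<close>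
  also have "(\<Sum>j\<in>J. \<Sum>k=0..N. w j * (p k j / c k * (v j \<bullet> d k))) = (\<Sum>k=0..N. (norm (d k))\<^sup>2 / c k)"
  proof (subst sum.swap, rule sum.cong[OF refl])
    fix k
    have "(\<Sum>j\<in>J. w j * (p k j / c k * (v j \<bullet> d k))) = (\<Sum>j\<in>J. (w j * p k j) *\<^sub>R v j) \<bullet> d k / c k"
      by (simp add: inner_sum_left sum_divide_distrib mult_ac)
    then show "(\<Sum>j\<in>J. w j * (p k j / c k * (v j \<bullet> d k))) = (norm (d k))\<^sup>2 / c k"
      by (simp only: d_def[symmetric] power2_norm_eq_inner)
  qed
  also have "(\<Sum>j\<in>J. \<Sum>k=0..N. \<Sum>l=0..N. w j * (p k j / c k * (p l j / c l) * (d k \<bullet> d l)))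
      = (\<Sum>k=0..N. \<Sum>l=0..N. (\<Sum>j\<in>J. w j * (p k j * p l j)) * (d k \<bullet> d l) / (c k * c l))"
    by (subst sum.swap, rule sum.cong, simp, subst sum.swap, rule sum.cong)
       (simp_all add: sum_distrib_left sum_divide_distrib mult_ac)
  \<comment> \<open>Off-diagonal terms vanish, and on the diagonal one factor \<open>c k\<close>
    cancels. The quadratic term thus offsets half of the cross term.\<close>
  also have "\<dots> = (\<Sum>k=0..N. (\<Sum>j\<in>J. w j * (p k j * p k j)) * (d k \<bullet> d k) / (c k * c k))"
    by (rule sum_diagonal) (simp add: orth)
  also have "\<dots> = (\<Sum>k=0..N. (norm (d k))\<^sup>2 / c k)"
    using c by (intro sum.cong) (auto simp: orth power2_norm_eq_inner dest: less_imp_neq)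
  finally show ?thesis by (simp add: d_def)
qed

section \<open>Support and moments of the distribution of \<open>\<xi>\<close>, and the location of
  the Gauss nodes\<close>

text \<open>Every point outside the support is the centre of a ball of measure zero. There may be
  uncountably many such balls, but by Lindelof countably many have the same union, which is
  therefore a null set.\<close>

lemma AE_in_distr_support:
  assumes "prob_space M" and [measurable]: "\<xi> \<in> borel_measurable M"
  shows "AE \<omega> in M. \<xi> \<omega> \<in> distr_support M \<xi>"
proof -
  interpret D: prob_space "distr M borel \<xi>"
    using assms by (simp add: prob_space.prob_space_distr)
  define F where "F = {ball x \<epsilon> |x \<epsilon>. \<epsilon> > 0 \<and> measure (distr M borel \<xi>) (ball x \<epsilon>) = 0}"
  obtain F' where F': "F' \<subseteq> F" "countable F'" "\<Union>F' = \<Union>F"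
    using Lindelof[of F] by (auto simp: F_def)
  have "(\<Union>B\<in>F'. B) \<in> null_sets (distr M borel \<xi>)"
    using F'(1,2) by (intro null_sets_UN') (auto simp: F_def D.emeasure_eq_measure intro!: null_setsI)
  then have "AE x in distr M borel \<xi>. x \<notin> \<Union>F'"
    by (intro AE_not_in) simp
  moreover have "x \<in> distr_support M \<xi>" if "x \<notin> \<Union>F'" for x
    unfolding distr_support_def
  proof (intro CollectI allI impI)
    fix \<epsilon> :: real assume "\<epsilon> > 0"
    then have "ball x \<epsilon> \<notin> F"
      using that F'(3) by (metis UnionI centre_in_ball)
    then show "measure (distr M borel \<xi>) (ball x \<epsilon>) > 0"
      using \<open>\<epsilon> > 0\<close> by (auto simp: F_def zero_less_measure_iff)
  qed
  ultimately have "AE x in distr M borel \<xi>. x \<in> distr_support M \<xi>" by auto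
  then show ?thesis by (rule AE_distrD[rotated]) simp
qed

lemma borel_measurable_poly [measurable (raw)]:
  fixes X :: "'a \<Rightarrow> real"
  assumes [measurable]: "X \<in> borel_measurable M"
  shows "(\<lambda>\<omega>. poly q (X \<omega>)) \<in> borel_measurable M"
  unfolding poly_altdef by measurable

text \<open>A single term of the exponential series at \<open>s * \<bar>x\<bar>\<close> is at most
  the whole series, and \<open>exp (s * \<bar>x\<bar>)\<close> is one of the two exponentials on the
  right. This dominates moments by the moment generating function at \<open>s\<close> and
  \<open>- s\<close>.\<close>

lemma power_abs_le_exp:
  fixes x s :: real
  assumes "s > 0"
  shows "\<bar>x\<bar> ^ n \<le> fact n / s ^ n * (exp (s * x) + exp (- s * x))"
proof -
  have "(s * \<bar>x\<bar>) ^ n / fact n \<le> exp (s * \<bar>x\<bar>)"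
  proof -
    have "(\<Sum>k\<in>{n}. (s * \<bar>x\<bar>) ^ k /\<^sub>R fact k) \<le> (\<Sum>k. (s * \<bar>x\<bar>) ^ k /\<^sub>R fact k)"
      using assms by (intro sum_le_suminf summable_exp_generic) auto
    then show ?thesis by (simp add: exp_def divide_inverse mult.commute)
  qed
  also have "\<dots> \<le> exp (s * x) + exp (- s * x)"
    by (cases "x \<ge> 0") (auto simp: abs_if)
  finally show ?thesis using assms by (simp add: power_mult_distrib field_simps)
qed

lemma integrable_poly_finite_mgf:
  assumes "prob_space M" and [measurable]: "\<xi> \<in> borel_measurable M"
    and "finite_mgf_near_0 M \<xi>"
  shows "integrable M (\<lambda>\<omega>. poly q (\<xi> \<omega>))"
proof -
  obtain \<epsilon> where \<epsilon>: "\<epsilon> > 0" "\<And>s. \<bar>s\<bar> < \<epsilon> \<Longrightarrow> integrable M (\<lambda>\<omega>. exp (s * \<xi> \<omega>))"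
    using assms(3) by (auto simp: finite_mgf_near_0_def)
  \<comment> \<open>Halving puts both \<open>s\<close> and \<open>- s\<close> strictly inside the
    range where the moment generating function is finite.\<close>
  define s where "s = \<epsilon> / 2"
  have s: "s > 0" "\<bar>s\<bar> < \<epsilon>" "\<bar>- s\<bar> < \<epsilon>" using \<epsilon> by (auto simp: s_def)
  have "integrable M (\<lambda>\<omega>. \<xi> \<omega> ^ n)" for n
  proof (rule Bochner_Integration.integrable_bound)
    show "integrable M (\<lambda>\<omega>. fact n / s ^ n * (exp (s * \<xi> \<omega>) + exp (- s * \<xi> \<omega>)))"
      using \<epsilon>(2)[OF s(2)] \<epsilon>(2)[OF s(3)] by (intro integrable_mult_right Bochner_Integration.integrable_add)
    show "AE \<omega> in M. norm (\<xi> \<omega> ^ n) \<le> norm (fact n / s ^ n * (exp (s * \<xi> \<omega>) + exp (- s * \<xi> \<omega>)))"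
    proof (rule AE_I2)
      fix \<omega>
      show "norm (\<xi> \<omega> ^ n) \<le> norm (fact n / s ^ n * (exp (s * \<xi> \<omega>) + exp (- s * \<xi> \<omega>)))"
        using power_abs_le_exp[OF s(1), of "\<xi> \<omega>" n] unfolding real_norm_def power_abs by linarith
    qed
  qed simp
  then show ?thesis unfolding poly_altdef by simp
qed

text \<open>Otherwise \<open>\<xi> - t\<close> would have a constant sign, whereas \<open>q = P (N + 1) / (x - t)\<close>
  has degree \<open>N\<close>, so \<open>E ((\<xi> - t) q(\<xi>)\<^sup>2) = E (P (N + 1)(\<xi>) q(\<xi>)) = 0\<close> by the quadrature.\<close>

lemma Gauss_node_in_value_interval:
  assumes M: "prob_space M" and \<xi>[measurable]: "\<xi> \<in> borel_measurable M"
    and mgf: "finite_mgf_near_0 M \<xi>"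
    and P: "orthogonal_polynomials M \<xi> P"
    and Q: "Gauss_quadrature M \<xi> P N z w"
    and t: "poly (P (N + 1)) t = 0"
  shows "t \<in> value_interval M \<xi>"
proof (rule ccontr)
  assume "t \<notin> value_interval M \<xi>"
  then obtain J where J: "is_interval J" "distr_support M \<xi> \<subseteq> J" "t \<notin> J"
    by (auto simp: value_interval_def)
  have deg: "degree (P (N + 1)) = N + 1" and pos: "sq_norm M \<xi> P (N + 1) > 0"
    using P by (auto simp: orthogonal_polynomials_def)
  obtain q where q: "P (N + 1) = [:- t, 1:] * q"
    using t by (metis dvdE poly_eq_0_iff_dvd)
  have poly_P: "poly (P (N + 1)) x = (x - t) * poly q x" for x
    unfolding q by (simp add: algebra_simps)
  have poly_Pq: "poly (P (N + 1) * q) x = (x - t) * (poly q x)\<^sup>2" for x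
    unfolding poly_mult poly_P by (simp add: power2_eq_square)
  have "q \<noteq> 0" using q deg by auto
  then have degq: "degree q = N"
    using deg unfolding q by (subst (asm) degree_mult_eq) auto
  have "(\<integral>\<omega>. poly (P (N + 1) * q) (\<xi> \<omega>) \<partial>M) = (\<Sum>j=1..N + 1. w j * poly (P (N + 1) * q) (z j))"
  proof -
    \<comment> \<open>The degree is at most \<open>(N + 1) + N\<close>, just within the exactness of
      the quadrature.\<close>
    have "degree (P (N + 1) * q) \<le> 2 * N + 1"
      using degree_mult_le[of "P (N + 1)" q] deg degq by simp
    then show ?thesis using Q unfolding Gauss_quadrature_def by blast
  qed
  \<comment> \<open>Every node is a root of \<open>P (N + 1)\<close>, so each summand is
    zero.\<close>
  also have "\<dots> = 0"
    using Q by (intro sum.neutral) (auto simp: Gauss_quadrature_def bij_betw_def)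
  finally have int0: "(\<integral>\<omega>. poly (P (N + 1) * q) (\<xi> \<omega>) \<partial>M) = 0" .
  \<comment> \<open>An interval that misses \<open>t\<close> lies on one side of it; the sign
    \<open>\<sigma>\<close> records the side and lets both cases be treated together.\<close>
  have "\<exists>\<sigma>\<in>{1, - 1 :: real}. \<forall>x\<in>J. \<sigma> * (x - t) \<ge> 0"
  proof (cases "\<exists>x\<in>J. x < t")
    case True
    then have "\<forall>x\<in>J. x \<le> t" using J by (meson is_interval_1 linear order.strict_implies_order)
    then show ?thesis by auto
  next
    case False
    then show ?thesis by (auto simp: not_less)
  qed
  then obtain \<sigma> :: real where "\<sigma> \<in> {1, -1}" and \<sigma>_sign: "\<forall>x\<in>J. \<sigma> * (x - t) \<ge> 0"
    by blast
  then have "\<sigma> \<noteq> 0" by auto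
  have "AE \<omega> in M. \<sigma> * poly (P (N + 1) * q) (\<xi> \<omega>) \<ge> 0"
    using AE_in_distr_support[OF M \<xi>]
  proof eventually_elim
    case (elim \<omega>)
    then have "\<sigma> * (\<xi> \<omega> - t) \<ge> 0" using \<sigma>_sign J by blast
    then have "\<sigma> * (\<xi> \<omega> - t) * (poly q (\<xi> \<omega>))\<^sup>2 \<ge> 0" by (rule mult_nonneg_nonneg) simp
    then show ?case by (simp only: poly_Pq mult.assoc)
  qed
  then have "AE \<omega> in M. \<sigma> * poly (P (N + 1) * q) (\<xi> \<omega>) = 0"
    using int0 integrable_poly_finite_mgf[OF M \<xi> mgf, of "P (N + 1) * q"]
    by (subst integral_nonneg_eq_0_iff_AE[symmetric]) auto
  \<comment> \<open>\<open>(x - t) * (poly q x)\<^sup>2 = 0\<close> forces \<open>x = t\<close> or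
    \<open>poly q x = 0\<close>, so \<open>P (N + 1)\<close> vanishes at \<open>x\<close> either
    way. This contradicts its positive norm.\<close>
  then have "AE \<omega> in M. (poly (P (N + 1)) (\<xi> \<omega>))\<^sup>2 = 0"
    by eventually_elim (use \<open>\<sigma> \<noteq> 0\<close> in \<open>unfold poly_Pq poly_P, auto\<close>)
  then have "sq_norm M \<xi> P (N + 1) = (\<integral>\<omega>. 0 \<partial>M)"
    unfolding sq_norm_def by (intro integral_cong_AE) auto
  then show False using pos by simp
qed

section \<open>The error of the orthogonal projection\<close>

lemma integrable_mult_of_squares:
  fixes f g :: "'a \<Rightarrow> real"
  assumes [measurable]: "f \<in> borel_measurable M" "g \<in> borel_measurable M"
    and "integrable M (\<lambda>x. (f x)\<^sup>2)" "integrable M (\<lambda>x. (g x)\<^sup>2)"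
  shows "integrable M (\<lambda>x. f x * g x)"
proof (rule Bochner_Integration.integrable_bound)
  show "integrable M (\<lambda>x. (f x)\<^sup>2 + (g x)\<^sup>2)" using assms by simp
  show "AE x in M. norm (f x * g x) \<le> norm ((f x)\<^sup>2 + (g x)\<^sup>2)"
  proof (rule AE_I2)
    fix x
    have "2 * (\<bar>f x\<bar> * \<bar>g x\<bar>) \<le> (f x)\<^sup>2 + (g x)\<^sup>2"
      using sum_squares_bound[of "\<bar>f x\<bar>" "\<bar>g x\<bar>"] by simp
    moreover have "0 \<le> \<bar>f x\<bar> * \<bar>g x\<bar>" by simp
    ultimately show "norm (f x * g x) \<le> norm ((f x)\<^sup>2 + (g x)\<^sup>2)"
      unfolding real_norm_def abs_mult by linarith
  qed
qed simp

context
  fixes M :: "'a measure" and \<xi> :: "'a \<Rightarrow> real" and P :: "nat \<Rightarrow> real poly"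
    and u :: "real \<Rightarrow> 'h::{real_inner, banach, second_countable_topology}"
  assumes M: "prob_space M" and \<xi>[measurable]: "\<xi> \<in> borel_measurable M"
    and mgf: "finite_mgf_near_0 M \<xi>"
    and P: "orthogonal_polynomials M \<xi> P"
    and u: "L2_random_element M (\<lambda>\<omega>. u (\<xi> \<omega>))"
begin

lemma integral_poly_mult_orthogonal:
  "(\<integral>\<omega>. poly (P k) (\<xi> \<omega>) * poly (P l) (\<xi> \<omega>) \<partial>M) = (if k = l then sq_norm M \<xi> P k else 0)"
  using P by (auto simp: orthogonal_polynomials_def sq_norm_def power2_eq_square)

lemma sq_norm_pos: "sq_norm M \<xi> P k > 0"
  using P by (auto simp: orthogonal_polynomials_def)

lemma integrable_poly_mult: "integrable M (\<lambda>\<omega>. poly p (\<xi> \<omega>) * poly q (\<xi> \<omega>))"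
  using integrable_poly_finite_mgf[OF M \<xi> mgf, of "p * q"] by simp

text \<open>Polynomials in \<open>\<xi>\<close> have finite second moments, so their products with
  square-integrable elements are integrable. Hence the chaos coefficients are genuine Bochner
  integrals and not the default value 0.\<close>

lemma integrable_poly_scaleR:
  fixes X :: "'a \<Rightarrow> 'h"
  assumes "L2_random_element M X"
  shows "integrable M (\<lambda>\<omega>. poly p (\<xi> \<omega>) *\<^sub>R X \<omega>)"
proof -
  have X[measurable]: "X \<in> borel_measurable M" and "integrable M (\<lambda>\<omega>. (norm (X \<omega>))\<^sup>2)"
    using assms by (auto simp: L2_random_element_def)
  then have "integrable M (\<lambda>\<omega>. \<bar>poly p (\<xi> \<omega>)\<bar> * norm (X \<omega>))"
    using integrable_poly_mult[of p p]
    by (intro integrable_mult_of_squares) (auto simp: power2_eq_square)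
  then show ?thesis
    by (rule Bochner_Integration.integrable_bound) auto
qed

lemma L2_random_element_orth_error:
  "L2_random_element M (\<lambda>\<omega>. u (\<xi> \<omega>) - orth_projection M \<xi> P u N (\<xi> \<omega>))"
proof -
  have "(\<lambda>\<omega>. u (\<xi> \<omega>)) \<in> borel_measurable M"
    and "integrable M (\<lambda>\<omega>. (norm (u (\<xi> \<omega>)))\<^sup>2)"
    using u by (auto simp: L2_random_element_def)
  moreover have "(\<lambda>\<omega>. orth_projection M \<xi> P u N (\<xi> \<omega>)) \<in> borel_measurable M"
    unfolding orth_projection_def by measurable
  moreover have "integrable M (\<lambda>\<omega>. poly (P k) (\<xi> \<omega>) / c * (u (\<xi> \<omega>) \<bullet> d))" for k c d
  proof -
    have "integrable M (\<lambda>\<omega>. (poly (P k) (\<xi> \<omega>) *\<^sub>R u (\<xi> \<omega>)) \<bullet> (d /\<^sub>R c))"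
      by (intro integrable_inner_left integrable_poly_scaleR u)
    then show ?thesis by (simp add: divide_inverse mult_ac)
  qed
  moreover have "integrable M (\<lambda>\<omega>. poly (P k) (\<xi> \<omega>) / c * (poly (P l) (\<xi> \<omega>) / c') * d)" for k l c c' d
    using integrable_mult_right[OF integrable_poly_mult[of "P k" "P l"], of "d / (c * c')"]
    by (simp add: mult_ac)
  ultimately show ?thesis
    unfolding L2_random_element_def
    by (intro conjI borel_measurable_diff) (simp_all add: orth_projection_def norm_diff_sum_squared)
qed

text \<open>Orthogonality leaves only the summand \<open>l = k\<close> of the projection. Its
  integral is the \<open>k\<close>-th chaos coefficient, the same as for \<open>u\<close>.\<close>

lemma integral_poly_scaleR_orth_error:
  assumes "k \<le> N"
  shows "(\<integral>\<omega>. poly (P k) (\<xi> \<omega>) *\<^sub>R (u (\<xi> \<omega>) - orth_projection M \<xi> P u N (\<xi> \<omega>)) \<partial>M) = 0"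
proof -
  let ?c = "sq_norm M \<xi> P" and ?u = "chaos_coeff M \<xi> P u"
  have eq: "poly (P k) t *\<^sub>R (u t - orth_projection M \<xi> P u N t)
      = poly (P k) t *\<^sub>R u t - (\<Sum>l=0..N. (poly (P k) t * poly (P l) t) *\<^sub>R (?u l /\<^sub>R ?c l))" for t
    by (simp add: orth_projection_def scaleR_diff_right scaleR_sum_right divide_inverse mult_ac)
  have "(\<integral>\<omega>. poly (P k) (\<xi> \<omega>) *\<^sub>R (u (\<xi> \<omega>) - orth_projection M \<xi> P u N (\<xi> \<omega>)) \<partial>M)
      = ?u k - (\<Sum>l=0..N. (\<integral>\<omega>. poly (P k) (\<xi> \<omega>) * poly (P l) (\<xi> \<omega>) \<partial>M) *\<^sub>R (?u l /\<^sub>R ?c l))"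
    unfolding eq chaos_coeff_def
    by (subst Bochner_Integration.integral_diff Bochner_Integration.integral_sum integral_scaleR_left;
        (intro integrable_poly_scaleR u Bochner_Integration.integrable_sum integrable_scaleR_left integrable_poly_mult)?)+ simp
  also have "(\<Sum>l=0..N. (\<integral>\<omega>. poly (P k) (\<xi> \<omega>) * poly (P l) (\<xi> \<omega>) \<partial>M) *\<^sub>R (?u l /\<^sub>R ?c l))
      = (\<Sum>l=0..N. if l = k then ?u k else 0)"
    using sq_norm_pos[of k] by (intro sum.cong) (auto simp: integral_poly_mult_orthogonal)
  finally show ?thesis using assms by simp
qed

text \<open>Here \<open>r\<close> is an arbitrary vector-valued polynomial of degree at most
  \<open>N\<close>, hence orthogonal to \<open>e\<close>; orthogonality of the \<open>P k\<close>
  evaluates its own mean square.\<close>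

lemma integral_orth_error_Pythagoras:
  fixes d :: "nat \<Rightarrow> 'h" and N :: nat
  defines "e \<equiv> \<lambda>t. u t - orth_projection M \<xi> P u N t"
    and "r \<equiv> \<lambda>t. \<Sum>k=0..N. (poly (P k) t / sq_norm M \<xi> P k) *\<^sub>R d k"
  shows "integrable M (\<lambda>\<omega>. (norm (e (\<xi> \<omega>) - r (\<xi> \<omega>)))\<^sup>2)" (is ?I)
    and "(\<integral>\<omega>. (norm (e (\<xi> \<omega>) - r (\<xi> \<omega>)))\<^sup>2 \<partial>M)
      = (\<integral>\<omega>. (norm (e (\<xi> \<omega>)))\<^sup>2 \<partial>M) + (\<Sum>k=0..N. (norm (d k))\<^sup>2 / sq_norm M \<xi> P k)" (is ?E)
proof -
  let ?c = "sq_norm M \<xi> P"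
  have e: "L2_random_element M (\<lambda>\<omega>. e (\<xi> \<omega>))"
    unfolding e_def by (rule L2_random_element_orth_error)
  \<comment> \<open>Each mixed term is arranged as a random factor with a known integral, paired
    with a fixed vector or number.\<close>
  have eq: "(norm (e t - r t))\<^sup>2 = (norm (e t))\<^sup>2
      - (\<Sum>k=0..N. (poly (P k) t *\<^sub>R e t) \<bullet> ((2 / ?c k) *\<^sub>R d k))
      + (\<Sum>k=0..N. \<Sum>l=0..N. poly (P k) t * poly (P l) t * ((d k \<bullet> d l) / (?c k * ?c l)))" for t
    unfolding r_def norm_diff_sum_squared
    by (simp add: sum_distrib_left mult_ac)
  have i1: "integrable M (\<lambda>\<omega>. (norm (e (\<xi> \<omega>)))\<^sup>2)"
    using e by (simp add: L2_random_element_def)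
  have i2: "integrable M (\<lambda>\<omega>. (poly (P k) (\<xi> \<omega>) *\<^sub>R e (\<xi> \<omega>)) \<bullet> x)" for k x
    by (intro integrable_inner_left integrable_poly_scaleR e)
  have i3: "integrable M (\<lambda>\<omega>. poly (P k) (\<xi> \<omega>) * poly (P l) (\<xi> \<omega>) * x)" for k l x
    by (intro integrable_mult_left integrable_poly_mult)
  note i = i1 i2 i3 Bochner_Integration.integrable_sum Bochner_Integration.integrable_diff
    Bochner_Integration.integrable_add
  show ?I unfolding eq by (intro i)
  have z: "(\<integral>\<omega>. (poly (P k) (\<xi> \<omega>) *\<^sub>R e (\<xi> \<omega>)) \<bullet> x \<partial>M) = 0" if "k \<le> N" for k x
    using integral_poly_scaleR_orth_error[OF that]
    by (subst integral_inner_left) (auto simp: e_def intro!: integrable_poly_scaleR L2_random_element_orth_error)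
  have "(\<integral>\<omega>. (norm (e (\<xi> \<omega>) - r (\<xi> \<omega>)))\<^sup>2 \<partial>M) = (\<integral>\<omega>. (norm (e (\<xi> \<omega>)))\<^sup>2 \<partial>M)
      - (\<Sum>k=0..N. \<integral>\<omega>. (poly (P k) (\<xi> \<omega>) *\<^sub>R e (\<xi> \<omega>)) \<bullet> ((2 / ?c k) *\<^sub>R d k) \<partial>M)
      + (\<Sum>k=0..N. \<Sum>l=0..N. \<integral>\<omega>. poly (P k) (\<xi> \<omega>) * poly (P l) (\<xi> \<omega>) * ((d k \<bullet> d l) / (?c k * ?c l)) \<partial>M)"
    unfolding eq
    by (subst Bochner_Integration.integral_add Bochner_Integration.integral_diff
        Bochner_Integration.integral_sum; (intro i)?)+ (rule refl)
  also have "(\<Sum>k=0..N. \<integral>\<omega>. (poly (P k) (\<xi> \<omega>) *\<^sub>R e (\<xi> \<omega>)) \<bullet> ((2 / ?c k) *\<^sub>R d k) \<partial>M) = 0"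
    by (intro sum.neutral ballI z) simp
  also have "(\<Sum>k=0..N. \<Sum>l=0..N. \<integral>\<omega>. poly (P k) (\<xi> \<omega>) * poly (P l) (\<xi> \<omega>) * ((d k \<bullet> d l) / (?c k * ?c l)) \<partial>M)
      = (\<Sum>k=0..N. \<integral>\<omega>. poly (P k) (\<xi> \<omega>) * poly (P k) (\<xi> \<omega>) * ((d k \<bullet> d k) / (?c k * ?c k)) \<partial>M)"
    by (rule sum_diagonal) (simp only: integral_mult_left_zero integral_poly_mult_orthogonal, simp)
  also have "\<dots> = (\<Sum>k=0..N. (norm (d k))\<^sup>2 / ?c k)"
    using sq_norm_pos
    by (intro sum.cong refl, unfold integral_mult_left_zero integral_poly_mult_orthogonal)
       (simp add: power2_norm_eq_inner less_imp_neq[symmetric])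
  finally show ?E by simp
qed

section \<open>Gauss quadrature and the error of the discrete projection\<close>

context
  fixes N :: nat and z w :: "nat \<Rightarrow> real"
  assumes Q: "Gauss_quadrature M \<xi> P N z w"
begin

text \<open>The product has degree at most \<open>2 * N\<close>, so the quadrature integrates it
  exactly. This supplies the orthogonality required by
  \<open>weighted_Bessel_inequality\<close>.\<close>

lemma Gauss_discrete_orthogonality:
  assumes "k \<le> N" "l \<le> N"
  shows "(\<Sum>j=1..N + 1. w j * (poly (P k) (z j) * poly (P l) (z j)))
    = (if k = l then sq_norm M \<xi> P k else 0)"
proof -
  have "degree (P k * P l) \<le> 2 * N + 1"
    using degree_mult_le[of "P k" "P l"] assms P by (auto simp: orthogonal_polynomials_def)
  then have "(\<integral>\<omega>. poly (P k * P l) (\<xi> \<omega>) \<partial>M) = (\<Sum>j=1..N + 1. w j * poly (P k * P l) (z j))"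
    using Q unfolding Gauss_quadrature_def by blast
  then show ?thesis using integral_poly_mult_orthogonal[of k l] by simp
qed

lemma sum_Gauss_weights: "(\<Sum>j=1..N + 1. w j) = 1"
proof -
  interpret prob_space M by (rule M)
  have "(\<integral>\<omega>. poly 1 (\<xi> \<omega>) \<partial>M) = (\<Sum>j=1..N + 1. w j * poly 1 (z j))"
    using Q unfolding Gauss_quadrature_def by (metis degree_1 zero_le)
  then show ?thesis by (simp add: prob_space)
qed

text \<open>By discrete orthogonality the discrete coefficients of the polynomial
  \<open>orth_projection\<close> are its exact ones, the chaos coefficients of
  \<open>u\<close>.\<close>

lemma discrete_coeff_error:
  assumes "k \<le> N"
  shows "discrete_coeff P N z w (\<lambda>t. u t - orth_projection M \<xi> P u N t) k
    = discrete_coeff P N z w u k - chaos_coeff M \<xi> P u k"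
proof -
  let ?c = "sq_norm M \<xi> P" and ?u = "chaos_coeff M \<xi> P u"
  have "(\<Sum>j=1..N + 1. (w j * poly (P k) (z j)) *\<^sub>R orth_projection M \<xi> P u N (z j))
      = (\<Sum>l=0..N. \<Sum>j=1..N + 1. (w j * (poly (P k) (z j) * poly (P l) (z j))) *\<^sub>R (?u l /\<^sub>R ?c l))"
    by (subst sum.swap) (simp add: orth_projection_def scaleR_sum_right divide_inverse mult_ac)
  also have "\<dots> = (\<Sum>l=0..N. (if k = l then ?c k else 0) *\<^sub>R (?u l /\<^sub>R ?c l))"
    using assms by (intro sum.cong refl)
      (simp only: scaleR_sum_left[symmetric] Gauss_discrete_orthogonality atLeastAtMost_iff)
  also have "\<dots> = (\<Sum>l=0..N. if l = k then ?u k else 0)"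
    using sq_norm_pos[of k] by (intro sum.cong) auto
  finally show ?thesis
    using assms by (simp add: discrete_coeff_def scaleR_diff_right sum_subtractf del: sum.cl_ivl_Suc)
qed

text \<open>The two projections differ by the discrete projection of the error (aliasing). This
  gives the form \<open>e - r\<close> needed for
  \<open>integral_orth_error_Pythagoras\<close>.\<close>

lemma discrete_projection_error:
  "u t - discrete_projection M \<xi> P z w u N t = u t - orth_projection M \<xi> P u N t
    - (\<Sum>k=0..N. (poly (P k) t / sq_norm M \<xi> P k) *\<^sub>R
        discrete_coeff P N z w (\<lambda>t. u t - orth_projection M \<xi> P u N t) k)"
proof -
  have "(\<Sum>k=0..N. (poly (P k) t / sq_norm M \<xi> P k) *\<^sub>R
        discrete_coeff P N z w (\<lambda>t. u t - orth_projection M \<xi> P u N t) k)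
     = (\<Sum>k=0..N. (poly (P k) t / sq_norm M \<xi> P k) *\<^sub>R
        (discrete_coeff P N z w u k - chaos_coeff M \<xi> P u k))"
    by (intro sum.cong refl) (simp add: discrete_coeff_error)
  also have "\<dots> = discrete_projection M \<xi> P z w u N t - orth_projection M \<xi> P u N t"
    by (simp add: discrete_projection_def orth_projection_def scaleR_diff_right sum_subtractf)
  finally show ?thesis by simp
qed

lemma discrete_projection_mean_square_error:
  "(\<integral>\<^sup>+ \<omega>. ennreal ((norm (u (\<xi> \<omega>) - discrete_projection M \<xi> P z w u N (\<xi> \<omega>)))\<^sup>2) \<partial>M)
    \<le> (\<integral>\<^sup>+ \<omega>. ennreal ((norm (u (\<xi> \<omega>) - orth_projection M \<xi> P u N (\<xi> \<omega>)))\<^sup>2) \<partial>M)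
      + ennreal (\<Sum>j=1..N + 1. w j * (norm (u (z j) - orth_projection M \<xi> P u N (z j)))\<^sup>2)"
proof -
  let ?e = "\<lambda>t. u t - orth_projection M \<xi> P u N t"
  let ?d = "discrete_coeff P N z w ?e"
  have w: "w j > 0" if "j \<in> {1..N + 1}" for j
    using Q that by (auto simp: Gauss_quadrature_def)
  have Bessel: "(\<Sum>k=0..N. (norm (?d k))\<^sup>2 / sq_norm M \<xi> P k) \<le> (\<Sum>j=1..N + 1. w j * (norm (?e (z j)))\<^sup>2)"
    unfolding discrete_coeff_def
    by (rule weighted_Bessel_inequality)
       (use w sq_norm_pos Gauss_discrete_orthogonality in \<open>auto simp: less_imp_le simp del: sum.cl_ivl_Suc\<close>)
  note Pyth = integral_orth_error_Pythagoras[of N ?d]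
  have ie: "integrable M (\<lambda>\<omega>. (norm (?e (\<xi> \<omega>)))\<^sup>2)"
    using L2_random_element_orth_error unfolding L2_random_element_def by blast
  have "(\<integral>\<^sup>+ \<omega>. ennreal ((norm (u (\<xi> \<omega>) - discrete_projection M \<xi> P z w u N (\<xi> \<omega>)))\<^sup>2) \<partial>M)
      = ennreal ((\<integral>\<omega>. (norm (?e (\<xi> \<omega>)))\<^sup>2 \<partial>M) + (\<Sum>k=0..N. (norm (?d k))\<^sup>2 / sq_norm M \<xi> P k))"
    unfolding discrete_projection_error Pyth(2)[symmetric]
    using Pyth(1) by (rule nn_integral_eq_integral) simp
  also have "\<dots> \<le> ennreal ((\<integral>\<omega>. (norm (?e (\<xi> \<omega>)))\<^sup>2 \<partial>M) + (\<Sum>j=1..N + 1. w j * (norm (?e (z j)))\<^sup>2))"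
    by (intro ennreal_leI add_left_mono Bessel)
  also have "\<dots> = ennreal (\<integral>\<omega>. (norm (?e (\<xi> \<omega>)))\<^sup>2 \<partial>M) + ennreal (\<Sum>j=1..N + 1. w j * (norm (?e (z j)))\<^sup>2)"
    using w by (intro ennreal_plus Bochner_Integration.integral_nonneg sum_nonneg) (auto simp: less_imp_le)
  also have "ennreal (\<integral>\<omega>. (norm (?e (\<xi> \<omega>)))\<^sup>2 \<partial>M) = (\<integral>\<^sup>+ \<omega>. ennreal ((norm (?e (\<xi> \<omega>)))\<^sup>2) \<partial>M)"
    using ie by (rule nn_integral_eq_integral[symmetric]) simp
  finally show ?thesis .
qed

text \<open>The left side is a weighted mean of squared errors at the nodes, since the weights are
  positive with sum 1. The nodes lie in the interval over which the supremum is taken.\<close>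

lemma Gauss_sum_error_le_sup_error:
  "ennreal (\<Sum>j=1..N + 1. w j * (norm (u (z j) - orth_projection M \<xi> P u N (z j)))\<^sup>2)
    \<le> (sup_error M \<xi> P u N)\<^sup>2"
proof (cases "sup_error M \<xi> P u N")
  case top
  then show ?thesis by simp
next
  case (real \<delta>)
  have "norm (u (z j) - orth_projection M \<xi> P u N (z j)) \<le> \<delta>" if "j \<in> {1..N + 1}" for j
  proof -
    have "poly (P (N + 1)) (z j) = 0"
      using Q that by (auto simp: Gauss_quadrature_def bij_betw_def)
    then have "z j \<in> value_interval M \<xi>"
      by (rule Gauss_node_in_value_interval[OF M \<xi> mgf P Q])
    then have "ennreal (norm (u (z j) - orth_projection M \<xi> P u N (z j))) \<le> sup_error M \<xi> P u N"
      unfolding sup_error_def by (rule SUP_upper)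
    then show ?thesis using real by simp
  qed
  moreover have "w j > 0" if "j \<in> {1..N + 1}" for j
    using Q that by (auto simp: Gauss_quadrature_def)
  ultimately have "(\<Sum>j=1..N + 1. w j * (norm (u (z j) - orth_projection M \<xi> P u N (z j)))\<^sup>2)
      \<le> (\<Sum>j=1..N + 1. w j * \<delta>\<^sup>2)"
    by (intro sum_mono mult_left_mono power_mono) (auto simp: less_imp_le)
  also have "\<dots> = \<delta>\<^sup>2"
    using sum_Gauss_weights by (simp only: sum_distrib_right[symmetric] mult_1)
  finally show ?thesis using real by (simp only: ennreal_power ennreal_leI)
qed

end

end

theorem theorem4p2:
  fixes M :: "'a measure"
    and \<xi> :: "'a \<Rightarrow> real"
    and G :: "plane set"
    and \<nu> :: real
    and \<iota> :: "vfield \<Rightarrow> 'h::{real_inner, banach, second_countable_topology}"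
    and \<kappa> :: "vfield \<Rightarrow> 'w::{real_inner, banach}"
    and P :: "nat \<Rightarrow> real poly"
    and f :: "real \<Rightarrow> ('w \<Rightarrow>\<^sub>L real)"
    and u :: "real \<Rightarrow> 'h"
    and N :: nat
    and z w :: "nat \<Rightarrow> real"
  assumes "prob_space M"
    and "\<xi> \<in> borel_measurable M"
    and "finite_mgf_near_0 M \<xi>"
    and "orthogonal_polynomials M \<xi> P"
    and "Lipschitz_domain G"
    and "\<nu> > 0"
    and "completion12 G (divfree_test_fields G) \<iota>"
    and "completion12 G (test_fields G) \<kappa>"
    and "L2_random_element M (\<lambda>\<omega>. f (\<xi> \<omega>))"
    and "\<forall>t\<in>value_interval M \<xi>. steady_NS_solution \<nu> G \<iota> \<kappa> (f t) (u t)"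
    and "L2_random_element M (\<lambda>\<omega>. u (\<xi> \<omega>))"
    and "N \<ge> 1"
    and "Gauss_quadrature M \<xi> P N z w"
  shows "(\<integral>\<^sup>+ \<omega>. ennreal ((norm (u (\<xi> \<omega>) - discrete_projection M \<xi> P z w u N (\<xi> \<omega>)))\<^sup>2) \<partial>M)
       \<le> (\<integral>\<^sup>+ \<omega>. ennreal ((norm (u (\<xi> \<omega>) - orth_projection M \<xi> P u N (\<xi> \<omega>)))\<^sup>2) \<partial>M)
         + of_nat N * (sup_error M \<xi> P u N)\<^sup>2"
proof -
  note M = \<open>prob_space M\<close> and \<xi> = \<open>\<xi> \<in> borel_measurable M\<close>
  note ctxt = M \<xi> \<open>finite_mgf_near_0 M \<xi>\<close> \<open>orthogonal_polynomials M \<xi> P\<close>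
    \<open>L2_random_element M (\<lambda>\<omega>. u (\<xi> \<omega>))\<close> \<open>Gauss_quadrature M \<xi> P N z w\<close>
  \<comment> \<open>The quadrature sum is bounded by the squared supremum with factor 1;
    \<open>N \<ge> 1\<close> enlarges this to the factor \<open>N\<close>, also when the supremum is
    infinite.\<close>
  have "1 * (sup_error M \<xi> P u N)\<^sup>2 \<le> of_nat N * (sup_error M \<xi> P u N)\<^sup>2"
    using \<open>N \<ge> 1\<close> of_nat_mono[of 1 N, where ?'a = ennreal] by (intro mult_right_mono) auto
  then have "ennreal (\<Sum>j=1..N + 1. w j * (norm (u (z j) - orth_projection M \<xi> P u N (z j)))\<^sup>2)
      \<le> of_nat N * (sup_error M \<xi> P u N)\<^sup>2"
    using Gauss_sum_error_le_sup_error[OF ctxt] by simp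
  then show ?thesis
    using discrete_projection_mean_square_error[OF ctxt] by (meson add_left_mono order_trans)
qed

end
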